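(* Let $n_k\ge1$, let $\mathbf{H}_k\in\mathbb{H}^{n_k}(\mathbb{R}^2)$ be a harmonic tensor and let $\mathrm{h}_k=\phi(\mathbf{H}_k)$ be the associated homogeneous harmonic polynomial of degree $n_k$, written $\mathrm{h}_k=\mathrm{Re}(\overline{z}_k z^{n_k})$ with $z_k\in\mathbb{C}$ and $z=x+iy$. Then the conjugate harmonic function $\widetilde{\mathrm{h}}_k$ satisfies $$\widetilde{\mathrm{h}}_k=\mathrm{Im}(\overline{z}_k z^{n_k})=\phi(\mathbf{1}\times\mathbf{H}_k).$$
   Context: $\mathbb{S}^n(\mathbb{R}^2)$ is the space of totally symmetric tensors of order $n$ on Euclidean $\mathbb{R}^2$; $\mathbb{H}^n(\mathbb{R}^2)\subset\mathbb{S}^n(\mathbb{R}^2)$ is the subspace of harmonic (traceless) tensors. $\phi(\mathbf{S})(\mathbf{x})=\mathbf{S}(\mathbf{x},\dots,\mathbf{x})$, $\mathbf{x}=(x,y)$, is the bijection between $\mathbb{S}^n(\mathbb{R}^2)$ and homogeneous polynomials of degree $n$ in $x,y$; it sends $\mathbb{H}^n(\mathbb{R}^2)$ onto harmonic homogeneous polynomials. Every such harmonic polynomial has the form $\mathrm{Re}(\overline{z}_kz^n)$, $z_k\in\mathbb{C}$, and its conjugate harmonic function is defined as $\mathrm{Im}(\overline{z}_kz^n)$. $\mathbf{1}$ is the identity second-order tensor. For $\mathbf{S}_1\in\mathbb{S}^{n_1}$, $\mathbf{S}_2\in\mathbb{S}^{n_2}$, $\mathbf{S}_1\times\mathbf{S}_2:=-(\mathbf{S}_1\cdot\boldsymbol{\varepsilon}\cdot\mathbf{S}_2)^s\in\mathbb{S}^{n_1+n_2-2}$,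 where $\boldsymbol{\varepsilon}$ is the Levi-Civita tensor ($\varepsilon_{ij}=\det(\mathbf{e}_i,\mathbf{e}_j)$), dots are single contractions and $(\cdot)^s$ is total symmetrization; in polynomial form $\phi(\mathbf{S}_1\times\mathbf{S}_2)=-\frac{1}{n_1n_2}\det(\nabla\mathrm{p}_1,\nabla\mathrm{p}_2)$ with $\mathrm{p}_i=\phi(\mathbf{S}_i)$. *)

theory Defs
  imports "HOL-Analysis.Analysis"
begin

text \<open>
  A tensor of order \<open>n\<close> on the Euclidean plane is an \<open>n\<close>-linear form, taking the list of its
  \<open>n\<close> vector arguments. It is extended by \<open>0\<close> to lists of any other length, so that
  equality of tensors is equality of functions.
\<close>

type_synonym tensor = "(real^2) list \<Rightarrow> real"

definition tensors :: "nat \<Rightarrow> tensor set" where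
  "tensors n = {T. (\<forall>vs. length vs \<noteq> n \<longrightarrow> T vs = 0) \<and>
     (\<forall>vs i. length vs = n \<longrightarrow> i < n \<longrightarrow> linear (\<lambda>v. T (vs[i := v])))}"

definition sym_tensors :: "nat \<Rightarrow> tensor set" where
  "sym_tensors n = {T \<in> tensors n.
     \<forall>\<sigma> vs. \<sigma> permutes {..<n} \<longrightarrow> length vs = n \<longrightarrow> T (permute_list \<sigma> vs) = T vs}"

text \<open>By symmetry all traces of a symmetric tensor agree, so it suffices to take the trace over
  the first two arguments. For \<open>n < 2\<close> there is no trace and the condition is void.\<close>

definition harmonic_tensors :: "nat \<Rightarrow> tensor set" where
  "harmonic_tensors n = {T \<in> sym_tensors n.
     \<forall>vs. length vs + 2 = n \<longrightarrow> (\<Sum>i\<in>UNIV. T (axis i 1 # axis i 1 # vs)) = 0}"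

definition poly_of_tensor :: "nat \<Rightarrow> tensor \<Rightarrow> real^2 \<Rightarrow> real" where
  "poly_of_tensor n T x = T (replicate n x)"

definition id_tensor :: tensor where
  "id_tensor vs = (if length vs = 2 then vs ! 0 \<bullet> vs ! 1 else 0)"

definition levi_civita :: tensor where
  "levi_civita vs = (if length vs = 2 then det (vector [vs ! 0, vs ! 1] :: real^2^2) else 0)"

text \<open>Single contraction, of the last argument of \<open>A\<close> (of order \<open>m \<ge> 1\<close>) with the first argument of
  \<open>B\<close> (of order \<open>n \<ge> 1\<close>).\<close>

definition contract :: "nat \<Rightarrow> nat \<Rightarrow> tensor \<Rightarrow> tensor \<Rightarrow> tensor" where
  "contract m n A B vs = (if length vs = m + n - 2
     then \<Sum>i\<in>UNIV. A (take (m - 1) vs @ [axis i 1]) * B (axis i 1 # drop (m - 1) vs)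
     else 0)"

definition symmetrize :: "nat \<Rightarrow> tensor \<Rightarrow> tensor" where
  "symmetrize n T vs = (if length vs = n
     then (\<Sum>\<sigma> | \<sigma> permutes {..<n}. T (permute_list \<sigma> vs)) / fact n
     else 0)"

text \<open>The contraction of a tensor of order \<open>m\<close> with \<open>levi_civita\<close> is again of order \<open>m\<close>.\<close>

definition tensor_cross :: "nat \<Rightarrow> nat \<Rightarrow> tensor \<Rightarrow> tensor \<Rightarrow> tensor" where
  "tensor_cross m n S T =
     (\<lambda>vs. - symmetrize (m + n - 2) (contract m n (contract m 2 S levi_civita) T) vs)"

definition to_complex :: "real^2 \<Rightarrow> complex" where
  "to_complex x = Complex (x $ 1) (x $ 2)"

text \<open>For \<open>n \<ge> 1\<close> the number \<open>w\<close> is determined by \<open>h\<close>, so the description below is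
  unique whenever \<open>h\<close> is a homogeneous harmonic polynomial of degree \<open>n\<close>.\<close>

definition conjugate_harmonic :: "nat \<Rightarrow> (real^2 \<Rightarrow> real) \<Rightarrow> real^2 \<Rightarrow> real" where
  "conjugate_harmonic n h = (THE g. \<exists>w.
     h = (\<lambda>x. Re (cnj w * to_complex x ^ n)) \<and> g = (\<lambda>x. Im (cnj w * to_complex x ^ n)))"

end

theory Submission imports Defs begin

text \<open>
  Identify the plane with \<open>\<complex>\<close>. The idea is that a harmonic tensor sees its arguments only through
  their complex product. For two slots held against fixed remaining arguments, symmetry and
  tracelessness leave only the entries \<open>H(e\<^sub>1,e\<^sub>1,\<dots>) = -H(e\<^sub>2,e\<^sub>2,\<dots>)\<close> and \<open>H(e\<^sub>1,e\<^sub>2,\<dots>)\<close>, and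
  expanding bilinearly gives \<open>H(a,b,\<dots>) = Re(ab) H(e\<^sub>1,e\<^sub>1,\<dots>) + Im(ab) H(e\<^sub>1,e\<^sub>2,\<dots>)\<close>, which is
  \<open>H(e\<^sub>1,ab,\<dots>)\<close> (\<open>harmonic_merge\<close>). The slice \<open>H(e\<^sub>1,\<dots>)\<close> is harmonic of order one less, so by
  induction there is a \<open>w\<close> with \<open>H(v\<^sub>1,\<dots>,v\<^sub>n) = Re(cnj w v\<^sub>1 \<cdots> v\<^sub>n)\<close>
  (\<open>harmonic_tensor_eq_Re_prod\<close>). On the diagonal this is the form \<open>Re(cnj w z\<^sup>n)\<close>, and \<open>w\<close> is
  determined by its diagonal values, since \<open>z\<^sup>n\<close> takes every complex value.

  Contracting \<open>\<one> \<cdot> \<epsilon>\<close> with \<open>H\<close> feeds the quarter turn \<open>i z\<close> of \<open>z\<close> to one slot of \<open>H\<close>. Hence the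
  polynomial of \<open>\<one> \<times> H\<close> is \<open>-H(i z,z,\<dots>,z) = -Re(i cnj w z\<^sup>n) = Im(cnj w z\<^sup>n)\<close>, which is the
  conjugate harmonic function.
\<close>

section \<open>The plane as the complex numbers\<close>

lemma Re_to_complex [simp]: "Re (to_complex x) = x $ 1"
  and Im_to_complex [simp]: "Im (to_complex x) = x $ 2"
  by (simp_all add: to_complex_def)

lemma to_complex_vector: "to_complex (vector [a, b]) = Complex a b"
  by (simp add: to_complex_def)

lemma surj_to_complex: "\<exists>x. to_complex x = c"
  using to_complex_vector[of "Re c" "Im c"] by auto

lemma linear_plane_expand:
  fixes f :: "real^2 \<Rightarrow> real"
  assumes "linear f"
  shows "f v = v $ 1 * f (axis 1 1) + v $ 2 * f (axis 2 1)"
proof -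
  have "v = v $ 1 *\<^sub>R axis 1 1 + v $ 2 *\<^sub>R axis 2 1"
    by (simp add: vec_eq_iff axis_def forall_2)
  then have "f v = f (v $ 1 *\<^sub>R axis 1 1 + v $ 2 *\<^sub>R axis 2 1)" by simp
  then show ?thesis by (simp add: linear_add[OF assms] linear_scale[OF assms])
qed

section \<open>Harmonic tensors are complex products\<close>

text \<open>This form of symmetry justifies a rearrangement of arguments without naming a permutation,
  and it passes to slices at once, because prepending an argument preserves equality of multisets.\<close>

lemma sym_tensors_iff_mset:
  "T \<in> sym_tensors n \<longleftrightarrow>
     T \<in> tensors n \<and> (\<forall>us vs. length vs = n \<longrightarrow> mset us = mset vs \<longrightarrow> T us = T vs)"
proof -
  have "T us = T vs"
    if "T \<in> sym_tensors n" "length vs = n" "mset us = mset vs" for us vs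
  proof -
    from that(3) obtain \<sigma> where "\<sigma> permutes {..<length vs}" "permute_list \<sigma> vs = us"
      by (rule mset_eq_permutation)
    then show ?thesis using that(1,2) unfolding sym_tensors_def by blast
  qed
  moreover have "mset (permute_list \<sigma> vs) = mset vs"
    if "\<sigma> permutes {..<n}" "length vs = n" for \<sigma> and vs :: "(real^2) list"
    using that by simp
  ultimately show ?thesis unfolding sym_tensors_def by blast
qed

lemma tensor_linear_head:
  assumes "T \<in> tensors (Suc n)" "length vs = n"
  shows "linear (\<lambda>v. T (v # vs))"
proof -
  have "length (0 # vs) = Suc n" "0 < Suc n" using assms(2) by auto
  then have "linear (\<lambda>v. T ((0 # vs)[0 := v]))"
    using assms(1) unfolding tensors_def by blast
  then show ?thesis by simp
qed

lemma tensors_slice: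
  assumes "T \<in> tensors (Suc n)"
  shows "(\<lambda>vs. T (a # vs)) \<in> tensors n"
  unfolding tensors_def
proof (intro CollectI conjI allI impI)
  fix vs :: "(real^2) list" assume "length vs \<noteq> n"
  then show "T (a # vs) = 0" using assms by (auto simp: tensors_def)
next
  fix vs :: "(real^2) list" and i assume "length vs = n" "i < n"
  then have "length (a # vs) = Suc n" "Suc i < Suc n" by auto
  then have "linear (\<lambda>v. T ((a # vs)[Suc i := v]))"
    using assms unfolding tensors_def by blast
  then show "linear (\<lambda>v. T (a # vs[i := v]))" by simp
qed

text \<open>The trace of the slice runs over the second and third slots of \<open>T\<close>. Symmetry moves the frozen
  argument behind them, where it is just one more spectator of the trace of \<open>T\<close>.\<close>

lemma harmonic_tensors_slice:
  assumes "T \<in> harmonic_tensors (Suc n)"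
  shows "(\<lambda>vs. T (a # vs)) \<in> harmonic_tensors n"
proof -
  from assms have T: "T \<in> tensors (Suc n)"
    and sym: "\<And>us vs. length vs = Suc n \<Longrightarrow> mset us = mset vs \<Longrightarrow> T us = T vs"
    and tr: "\<And>vs. length vs + 2 = Suc n \<Longrightarrow> (\<Sum>i\<in>UNIV. T (axis i 1 # axis i 1 # vs)) = 0"
    unfolding harmonic_tensors_def sym_tensors_iff_mset by blast+
  have "(\<Sum>i\<in>UNIV. T (a # axis i 1 # axis i 1 # vs)) = 0" if "length vs + 2 = n" for vs
  proof -
    have "T (a # axis i 1 # axis i 1 # vs) = T (axis i 1 # axis i 1 # a # vs)" for i
      using that by (intro sym) auto
    then show ?thesis using tr[of "a # vs"] that by simp
  qed
  moreover have "(\<lambda>vs. T (a # vs)) \<in> sym_tensors n"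
    unfolding sym_tensors_iff_mset using tensors_slice[OF T] by (auto intro!: sym)
  ultimately show ?thesis unfolding harmonic_tensors_def by blast
qed

lemma harmonic_merge:
  assumes T: "T \<in> harmonic_tensors (Suc (Suc n))" and len: "length vs = n"
    and c: "to_complex c = to_complex a * to_complex b"
  shows "T (a # b # vs) = T (axis 1 1 # c # vs)"
proof -
  let ?e = "\<lambda>i::2. axis i 1 :: real^2"
  have tens: "T \<in> tensors (Suc (Suc n))"
    and sym: "\<And>x y. T (x # y # vs) = T (y # x # vs)"
    and tr: "(\<Sum>i\<in>UNIV. T (?e i # ?e i # vs)) = 0"
    using T len unfolding harmonic_tensors_def sym_tensors_iff_mset by auto
  have lin: "linear (\<lambda>x. T (x # y # vs))" for y
    using tens len by (intro tensor_linear_head) auto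
  note expand1 = linear_plane_expand[OF lin]
  have expand2: "T (x # y # vs) = y $ 1 * T (x # ?e 1 # vs) + y $ 2 * T (x # ?e 2 # vs)" for x y
    using expand1[of y x] by (simp only: sym[of x])
  have diag: "T (?e 2 # ?e 2 # vs) = - T (?e 1 # ?e 1 # vs)"
    using tr by (simp add: sum_2)
  have "c $ 1 = a $ 1 * b $ 1 - a $ 2 * b $ 2" "c $ 2 = a $ 1 * b $ 2 + a $ 2 * b $ 1"
    using arg_cong[OF c, of Re] arg_cong[OF c, of Im] by simp_all
  then have "T (?e 1 # c # vs) = (a $ 1 * b $ 1 - a $ 2 * b $ 2) * T (?e 1 # ?e 1 # vs)
      + (a $ 1 * b $ 2 + a $ 2 * b $ 1) * T (?e 1 # ?e 2 # vs)"
    using expand2[of "?e 1" c] by simp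
  moreover have "T (a # b # vs) =
      a $ 1 * (b $ 1 * T (?e 1 # ?e 1 # vs) + b $ 2 * T (?e 1 # ?e 2 # vs))
    + a $ 2 * (b $ 1 * T (?e 1 # ?e 2 # vs) + b $ 2 * T (?e 2 # ?e 2 # vs))"
    using expand1[of a b] expand2[of "?e 1" b] expand2[of "?e 2" b] sym[of "?e 2" "?e 1"] by simp
  ultimately show ?thesis by (simp add: diag algebra_simps)
qed

text \<open>Each merge moves one complex factor into the next slot and leaves \<open>e\<^sub>1\<close>, the complex number
  \<open>1\<close>, behind. Freezing that slot lowers the order until a single linear form on the plane remains,
  and such a form is \<open>Re (cnj w z)\<close>.\<close>

lemma harmonic_tensor_eq_Re_prod:
  assumes "T \<in> harmonic_tensors (Suc n)"
  shows "\<exists>w. \<forall>vs. length vs = Suc n \<longrightarrow> T vs = Re (cnj w * prod_list (map to_complex vs))"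
  using assms
proof (induction n arbitrary: T)
  case 0
  then have "T \<in> tensors (Suc 0)" by (simp add: harmonic_tensors_def sym_tensors_def)
  then have "linear (\<lambda>v. T [v])" by (rule tensor_linear_head) simp
  note expand = linear_plane_expand[OF this]
  have "T vs = Re (cnj (Complex (T [axis 1 1]) (T [axis 2 1])) * prod_list (map to_complex vs))"
    if len: "length vs = Suc 0" for vs
  proof -
    obtain v where "vs = [v]" using len by (cases vs) auto
    then show ?thesis using expand[of v] by (simp add: algebra_simps)
  qed
  then show ?case by blast
next
  case (Suc n)
  from Suc.IH[OF harmonic_tensors_slice[OF Suc.prems, of "axis 1 1"]]
  obtain w where w: "\<And>us. length us = Suc n \<Longrightarrow>
      T (axis 1 1 # us) = Re (cnj w * prod_list (map to_complex us))" by blast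
  have "T vs = Re (cnj w * prod_list (map to_complex vs))" if len: "length vs = Suc (Suc n)" for vs
  proof -
    obtain a b us where vs: "vs = a # b # us" and us: "length us = n"
      using len by (auto simp: length_Suc_conv)
    obtain c where c: "to_complex c = to_complex a * to_complex b"
      using surj_to_complex by blast
    have "T vs = T (axis 1 1 # c # us)"
      unfolding vs using harmonic_merge[OF Suc.prems us c] .
    also have "\<dots> = Re (cnj w * prod_list (map to_complex (c # us)))"
      using us by (intro w) simp
    finally show ?thesis by (simp only: vs c list.map prod_list.Cons mult.assoc)
  qed
  then show ?case by blast
qed

section \<open>The coefficient and the conjugate function\<close>

text \<open>If \<open>d\<close> is the difference of the two conjugated coefficients, then \<open>Re (d z\<^sup>n) = 0\<close> for all
  \<open>z\<close>. Choosing \<open>z\<close> as an \<open>n\<close>-th root of \<open>cnj d\<close> turns this into \<open>\<bar>d\<bar>\<^sup>2 = 0\<close>.\<close>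

lemma Re_coefficient_unique:
  assumes "n \<ge> 1"
    and eq: "\<And>x. Re (cnj w * to_complex x ^ n) = Re (cnj w' * to_complex x ^ n)"
  shows "w = w'"
proof -
  let ?d = "cnj (w - w')"
  obtain z where z: "cnj ?d = z ^ n" using exists_complex_root[of n "cnj ?d"] assms(1) by auto
  obtain x where x: "to_complex x = z" using surj_to_complex by blast
  have "Re (?d * cnj ?d) = 0"
    using eq[of x] unfolding x z by (simp add: algebra_simps)
  then have "cmod ?d ^ 2 = 0" by (simp only: complex_norm_square[symmetric] Re_complex_of_real)
  then show ?thesis by simp
qed

lemma conjugate_harmonic_Re_power:
  assumes "n \<ge> 1"
  shows "conjugate_harmonic n (\<lambda>x. Re (cnj w * to_complex x ^ n))
    = (\<lambda>x. Im (cnj w * to_complex x ^ n))"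
  unfolding conjugate_harmonic_def
proof (rule the_equality, goal_cases)
  case 1
  show ?case by blast
next
  case (2 g)
  then obtain w' where
    w': "(\<lambda>x. Re (cnj w * to_complex x ^ n)) = (\<lambda>x. Re (cnj w' * to_complex x ^ n))"
    and g: "g = (\<lambda>x. Im (cnj w' * to_complex x ^ n))" by blast
  have "w = w'" using assms fun_cong[OF w'] by (rule Re_coefficient_unique)
  then show ?case using g by simp
qed

section \<open>The cross product with the identity tensor\<close>

lemma poly_of_symmetrize: "poly_of_tensor n (symmetrize n T) = poly_of_tensor n T"
proof -
  have "permute_list \<sigma> (replicate n x) = replicate n x" if "\<sigma> permutes {..<n}" for \<sigma> and x :: "real^2"
    using that permutes_in_image[OF that] by (intro nth_equalityI) (auto simp: permute_list_nth)
  then show ?thesis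
    by (simp add: poly_of_tensor_def symmetrize_def fun_eq_iff card_permutations)
qed

text \<open>On the diagonal the symmetrization disappears, and what is left is a contraction of \<open>T\<close>
  against the covector \<open>x \<cdot> \<epsilon> = (-x\<^sub>2, x\<^sub>1)\<close>: the first slot of \<open>T\<close> receives \<open>x\<close> turned by a right
  angle.\<close>

lemma poly_of_id_cross:
  assumes "T \<in> tensors (Suc n)"
  shows "poly_of_tensor (Suc n) (tensor_cross 2 (Suc n) id_tensor T) x
    = - T (vector [- x $ 2, x $ 1] # replicate n x)"
proof -
  have eps: "contract 2 2 id_tensor levi_civita [x, axis 1 1] = - x $ 2"
    "contract 2 2 id_tensor levi_civita [x, axis 2 1] = x $ 1"
    by (simp_all add: contract_def id_tensor_def levi_civita_def sum_2 det_2 inner_axis)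
       (simp_all add: axis_def)
  have "poly_of_tensor (Suc n) (tensor_cross 2 (Suc n) id_tensor T) x
    = - poly_of_tensor (Suc n) (symmetrize (Suc n)
        (contract 2 (Suc n) (contract 2 2 id_tensor levi_civita) T)) x"
    by (simp add: tensor_cross_def poly_of_tensor_def)
  also have "\<dots> = - (- x $ 2 * T (axis 1 1 # replicate n x) + x $ 1 * T (axis 2 1 # replicate n x))"
    unfolding poly_of_symmetrize by (simp add: poly_of_tensor_def contract_def[of 2 "Suc n"] sum_2 eps)
  also have "\<dots> = - T (vector [- x $ 2, x $ 1] # replicate n x)"
    using linear_plane_expand[OF tensor_linear_head[OF assms], of "replicate n x" "vector [- x $ 2, x $ 1]"]
    by simp
  finally show ?thesis .
qed

theorem theorem7p2:
  fixes n :: nat and H :: tensor and h :: "real^2 \<Rightarrow> real"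
  assumes "n \<ge> 1"
    and "H \<in> harmonic_tensors n"
    and "h = poly_of_tensor n H"
  shows "(\<exists>w. h = (\<lambda>x. Re (cnj w * to_complex x ^ n))) \<and>
    (\<forall>w. h = (\<lambda>x. Re (cnj w * to_complex x ^ n)) \<longrightarrow>
       conjugate_harmonic n h = (\<lambda>x. Im (cnj w * to_complex x ^ n)) \<and>
       (\<lambda>x. Im (cnj w * to_complex x ^ n)) = poly_of_tensor n (tensor_cross 2 n id_tensor H))"
proof -
  obtain m where n: "n = Suc m" using assms(1) by (cases n) auto
  have tens: "H \<in> tensors (Suc m)"
    using assms(2) by (simp add: n harmonic_tensors_def sym_tensors_def)
  obtain u where u: "\<And>vs. length vs = n \<Longrightarrow> H vs = Re (cnj u * prod_list (map to_complex vs))"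
    using harmonic_tensor_eq_Re_prod assms(2) unfolding n by blast
  have h: "h = (\<lambda>x. Re (cnj u * to_complex x ^ n))"
    by (simp add: assms(3) poly_of_tensor_def fun_eq_iff u map_replicate prod_list_replicate)
  have cross: "poly_of_tensor n (tensor_cross 2 n id_tensor H) x = Im (cnj u * to_complex x ^ n)" for x
  proof -
    have turn: "to_complex (vector [- x $ 2, x $ 1]) = \<i> * to_complex x"
      by (simp add: to_complex_vector complex_eq_iff)
    have "poly_of_tensor n (tensor_cross 2 n id_tensor H) x
      = - Re (cnj u * (\<i> * to_complex x * to_complex x ^ m))"
      using poly_of_id_cross[OF tens] u[of "vector [- x $ 2, x $ 1] # replicate m x"]
      by (simp only: n turn length_Cons length_replicate list.map prod_list.Cons
          map_replicate prod_list_replicate)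
    also have "cnj u * (\<i> * to_complex x * to_complex x ^ m) = \<i> * (cnj u * to_complex x ^ n)"
      by (simp add: n mult_ac)
    finally show ?thesis by simp
  qed
  have "conjugate_harmonic n h = (\<lambda>x. Im (cnj w * to_complex x ^ n)) \<and>
       (\<lambda>x. Im (cnj w * to_complex x ^ n)) = poly_of_tensor n (tensor_cross 2 n id_tensor H)"
    if w: "h = (\<lambda>x. Re (cnj w * to_complex x ^ n))" for w
  proof -
    have "w = u"
      using w h by (intro Re_coefficient_unique[OF assms(1)]) (metis (full_types))
    then show ?thesis
      using conjugate_harmonic_Re_power[OF assms(1), of u] h cross by auto
  qed
  then show ?thesis using h by blast
qed

end
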